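(* Let $C_n$ be the cycle graph on $n\ge 3$ vertices. Then \[ \mathrm{mpd}(C_n)=\begin{cases}\infty, & \text{if } n\le 7,\\ 5, & \text{if } n=8,\\ 4, & \text{if } n\ge 9.\end{cases} \]
   Context: $d(u,v)$ denotes the shortest-path distance. Let $G$ be a connected graph and let $\Pi=\{S_1,\dots,S_t\}$ be a partition of $V(G)$ into nonempty parts. For $v\in V(G)$ put $d(v,S_i)=\min\{d(v,x):x\in S_i\}$. The multiset partition representation of $v$ with respect to $\Pi$ is the multiset $r_{mp}(v\mid\Pi)=\{d(v,S_1),\dots,d(v,S_t)\}$ (order ignored, multiplicities kept). $\Pi$ is a resolving multiset partition if $r_{mp}(u\mid\Pi)\ne r_{mp}(v\mid\Pi)$ for all distinct $u,v\in V(G)$. The multiset partition dimension $\mathrm{mpd}(G)$ is the minimum number $t$ of parts of a resolving multiset partition of $G$, and $\mathrm{mpd}(G)=\infty$ if none exists. *)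

theory Defs
  imports
    "Graph_Theory.Digraph_Component"
    "Graph_Theory.Shortest_Path"
    "HOL-Library.Disjoint_Sets"
    "HOL-Library.Multiset"
    "HOL-Library.Extended_Nat"
begin

text \<open>
  An undirected graph is a finite, loop-free, symmetric digraph without multiple arcs (locale
  \<^locale>\<open>graph\<close>). The definitions below are meant for such graphs that are moreover connected;
  there every vertex set is finite, so that \<^const>\<open>Min\<close> and \<^const>\<open>mset_set\<close> are only applied to
  finite sets.
\<close>

text \<open>
  The shortest-path distance is the minimum cost of a walk when every arc costs 1; the values lie
  in \<^typ>\<open>ereal\<close> because that is the type of the shortest-path function of the library.
\<close>

definition graph_dist :: "('a, 'b) pre_digraph \<Rightarrow> 'a \<Rightarrow> 'a \<Rightarrow> ereal" where
  "graph_dist G u v = wf_digraph.\<mu> G (\<lambda>_. 1) u v"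

definition dist_to_set :: "('a, 'b) pre_digraph \<Rightarrow> 'a \<Rightarrow> 'a set \<Rightarrow> ereal" where
  "dist_to_set G v S = Min (graph_dist G v ` S)"

definition mp_representation ::
    "('a, 'b) pre_digraph \<Rightarrow> 'a set set \<Rightarrow> 'a \<Rightarrow> ereal multiset" where
  "mp_representation G P v = image_mset (dist_to_set G v) (mset_set P)"

definition resolving_multiset_partition :: "('a, 'b) pre_digraph \<Rightarrow> 'a set set \<Rightarrow> bool" where
  "resolving_multiset_partition G P \<longleftrightarrow>
     partition_on (verts G) P \<and>
     (\<forall>u\<in>verts G. \<forall>v\<in>verts G. u \<noteq> v \<longrightarrow> mp_representation G P u \<noteq> mp_representation G P v)"

text \<open>
  In \<^typ>\<open>enat\<close> the infimum of a nonempty set is its minimum, and the infimum of the empty set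
  is \<open>\<infinity>\<close>.
\<close>

definition mpd :: "('a, 'b) pre_digraph \<Rightarrow> enat" where
  "mpd G = Inf {enat (card P) | P. resolving_multiset_partition G P}"

text \<open>Each undirected edge is represented by its two opposite arcs.\<close>

definition cycle_graph :: "nat \<Rightarrow> (nat, nat \<times> nat) pre_digraph" where
  "cycle_graph n =
     \<lparr>verts = {0..<n},
      arcs = {(u, v). u < n \<and> v < n \<and> (v = (u + 1) mod n \<or> u = (v + 1) mod n)},
      tail = fst, head = snd\<rparr>"

lemma graph_cycle_graph:
  assumes "n \<ge> 3"
  shows "graph (cycle_graph n)"
proof
  show "finite (arcs (cycle_graph n))"
    by (rule finite_subset[of _ "{0..<n} \<times> {0..<n}"]) (auto simp: cycle_graph_def)
next
  fix e assume "e \<in> arcs (cycle_graph n)"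
  then show "tail (cycle_graph n) e \<noteq> head (cycle_graph n) e"
    using assms by (auto simp: cycle_graph_def mod_Suc split: if_splits)
qed (auto simp: cycle_graph_def symmetric_def arcs_ends_def arc_to_ends_def intro!: symI)

lemma connected_cycle_graph:
  assumes "n \<ge> 3"
  shows "connected (cycle_graph n)"
proof -
  interpret graph "cycle_graph n" by (rule graph_cycle_graph[OF assms])
  have from_0: "0 \<rightarrow>\<^sup>*\<^bsub>cycle_graph n\<^esub> k" if "k < n" for k
    using that
  proof (induction k)
    case 0
    then have "0 \<in> verts (cycle_graph n)" by (simp add: cycle_graph_def)
    then show ?case by (rule reachable_refl)
  next
    case (Suc k)
    have "k \<rightarrow>\<^bsub>cycle_graph n\<^esub> Suc k"
      using Suc.prems by (auto simp: cycle_graph_def arcs_ends_def arc_to_ends_def)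
    with Suc show ?case by (meson Suc_lessD reachable_adj_trans)
  qed
  have "strongly_connected (cycle_graph n)"
    unfolding strongly_connected_def
  proof (intro conjI ballI)
    show "verts (cycle_graph n) \<noteq> {}" using assms by (auto simp: cycle_graph_def)
  next
    fix u v assume "u \<in> verts (cycle_graph n)" "v \<in> verts (cycle_graph n)"
    then have "u < n" "v < n" by (simp_all add: cycle_graph_def)
    then have "0 \<rightarrow>\<^sup>*\<^bsub>cycle_graph n\<^esub> u" "0 \<rightarrow>\<^sup>*\<^bsub>cycle_graph n\<^esub> v"
      by (blast intro: from_0)+
    then show "u \<rightarrow>\<^sup>*\<^bsub>cycle_graph n\<^esub> v"
      using symmetric_reachable[OF sym_arcs] reachable_trans by blast
  qed
  then show ?thesis
    unfolding connected_def strongly_connected_def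
    by (simp add: reachable_mk_symmetric_eq[OF sym_arcs])
qed

end

theory Submission
  imports Defs
begin

text \<open>
  For at most 7 vertices, and for 8 vertices with at most 4 parts, all partitions are searched. For
  general \<open>n\<close> three parts never suffice, because a shortest arc meeting all parts contains two vertices
  with equal representations. For \<open>n \<ge> 9\<close> the parts \<open>{0}, {1}, {4}\<close> and the remaining vertices resolve
  the cycle: a vertex \<open>k\<close> to the right of them sees the distances \<open>k - 4, k - 1, k\<close>, a vertex to the
  left sees \<open>k, k + 1, k + 4\<close>, and the asymmetric spacing \<open>1, 3\<close> keeps these apart.
\<close>

section \<open>Distances in the cycle\<close>

text \<open>A closed form that rewriting can evaluate; \<open>graph_dist_cycle_graph\<close>
  identifies it with \<open>graph_dist\<close>. The conditional avoids truncated
  subtraction.\<close>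

definition cyc_dist :: "nat \<Rightarrow> nat \<Rightarrow> nat \<Rightarrow> nat" where
  "cyc_dist n u v = (let d = (if u \<le> v then v - u else u - v) in min d (n - d))"

lemma cyc_dist_commute: "cyc_dist n u v = cyc_dist n v u"
  by (auto simp: cyc_dist_def Let_def)

lemma cyc_dist_eq_0_iff: "u < n \<Longrightarrow> v < n \<Longrightarrow> cyc_dist n u v = 0 \<longleftrightarrow> u = v"
  by (auto simp: cyc_dist_def Let_def min_def)

text \<open>Over the integers no subtraction truncates, so linear arithmetic can work with the
  distance.\<close>

lemma int_cyc_dist:
  assumes "u < n" "v < n"
  shows "int (cyc_dist n u v) = min \<bar>int u - int v\<bar> (int n - \<bar>int u - int v\<bar>)"
proof -
  define d where "d = (if u \<le> v then v - u else u - v)"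
  have "int d = \<bar>int u - int v\<bar>" by (auto simp: d_def)
  moreover have "d \<le> n" using assms by (auto simp: d_def)
  moreover have "cyc_dist n u v = min d (n - d)" by (simp add: cyc_dist_def d_def Let_def)
  ultimately show ?thesis by (simp add: of_nat_min of_nat_diff)
qed

text \<open>Applied along a walk, this shows that no walk to \<open>v\<close> is shorter than
  \<open>cyc_dist\<close>.\<close>

lemma cyc_dist_arc:
  assumes "(u, u') \<in> arcs (cycle_graph n)" "v < n"
  shows "cyc_dist n u v \<le> Suc (cyc_dist n u' v)"
proof -
  have "u < n" "u' < n" "u' = u + 1 \<or> u = n - 1 \<and> u' = 0 \<or> u = u' + 1 \<or> u' = n - 1 \<and> u = 0"
    using assms(1) by (auto simp: cycle_graph_def mod_Suc split: if_splits)
  then consider "u' = u + 1" | "u = n - 1" "u' = 0" | "u = u' + 1" | "u' = n - 1" "u = 0"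
    by blast
  then show ?thesis
  proof cases
    case 1
    then show ?thesis
      using \<open>u' < n\<close> assms(2)
      by (cases "u < v"; cases "v = u") (simp_all add: cyc_dist_def Let_def)
  next
    case 2
    then show ?thesis
      using \<open>u < n\<close> assms(2) by (auto simp: cyc_dist_def Let_def)
  next
    case 3
    then show ?thesis
      using \<open>u < n\<close> assms(2)
      by (cases "u' < v"; cases "v = u'") (simp_all add: cyc_dist_def Let_def)
  next
    case 4
    then show ?thesis
      using \<open>u' < n\<close> assms(2) by (auto simp: cyc_dist_def Let_def)
  qed
qed

lemma cycle_graph_arcs:
  "Suc u < n \<Longrightarrow> (u, Suc u) \<in> arcs (cycle_graph n)"
  "Suc u < n \<Longrightarrow> (Suc u, u) \<in> arcs (cycle_graph n)"
  "(m, 0) \<in> arcs (cycle_graph (Suc m))"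
  "(0, m) \<in> arcs (cycle_graph (Suc m))"
  by (simp_all add: cycle_graph_def)

text \<open>The neighbour lies on the shorter way round: towards \<open>v\<close> if the direct gap
  \<open>Suc d\<close> is at most \<open>n - Suc d\<close>, and otherwise in the opposite direction,
  wrapping between \<open>0\<close> and the last vertex \<open>m\<close> if necessary.\<close>

lemma cyc_dist_decrease:
  assumes "u < n" "v < n" "u \<noteq> v"
  obtains u' where "(u, u') \<in> arcs (cycle_graph n)" "Suc (cyc_dist n u' v) = cyc_dist n u v"
proof -
  obtain m where n: "n = Suc m" using assms(1) by (cases n) auto
  show thesis
  proof (cases u v rule: linorder_cases)
    case less
    then obtain d where v: "v = Suc (u + d)" using less_imp_Suc_add by blast
    show thesis
    proof (cases "Suc d \<le> n - Suc d")
      case True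
      then show thesis
        using assms v by (intro that[of "Suc u"] cycle_graph_arcs) (simp_all add: cyc_dist_def Let_def)
    next
      case far: False
      show thesis
      proof (cases u)
        case 0
        then show thesis
          using assms v far n cycle_graph_arcs(4)[of m]
          by (intro that[of m]) (auto simp: cyc_dist_def Let_def)
      next
        case (Suc u')
        then show thesis
          using assms v far cycle_graph_arcs(2)[of u' n]
          by (intro that[of u']) (auto simp: cyc_dist_def Let_def)
      qed
    qed
  next
    case greater
    then obtain d where u: "u = Suc (v + d)" using less_imp_Suc_add by blast
    show thesis
    proof (cases "Suc d \<le> n - Suc d")
      case True
      then show thesis
        using assms u cycle_graph_arcs(2)[of "v + d" n]
        by (intro that[of "v + d"]) (simp_all add: cyc_dist_def Let_def)
    next
      case far: False
      show thesis
      proof (cases "u = m")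
        case True
        then show thesis
          using assms u far n cycle_graph_arcs(3)[of m]
          by (intro that[of 0]) (auto simp: cyc_dist_def Let_def)
      next
        case False
        then show thesis
          using assms u far n cycle_graph_arcs(1)[of u n]
          by (intro that[of "Suc u"]) (auto simp: cyc_dist_def Let_def)
      qed
    qed
  qed (use assms in simp)
qed

lemma (in wf_digraph) awalk_cost_one: "awalk_cost (\<lambda>_. 1) p = real (length p)"
  by (induction p) auto

text \<open>The infimum over all walks is attained: \<open>lower\<close> bounds every walk by
  induction on its arcs, and \<open>upper\<close> builds a walk of the right length by induction on
  the distance.\<close>

lemma graph_dist_cycle_graph:
  assumes "n \<ge> 3" "u < n" "v < n"
  shows "graph_dist (cycle_graph n) u v = ereal (real (cyc_dist n u v))"
proof -
  interpret graph "cycle_graph n" by (rule graph_cycle_graph[OF assms(1)])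
  have ends: "tail (cycle_graph n) = fst" "head (cycle_graph n) = snd"
    and verts: "verts (cycle_graph n) = {0..<n}"
    by (simp_all add: cycle_graph_def)
  have lower: "cyc_dist n u v \<le> length p" if "awalk u p v" for u p
    using that
  proof (induction p arbitrary: u)
    case Nil
    then show ?case by (simp add: awalk_Nil_iff cyc_dist_def)
  next
    case (Cons e p)
    then have "(u, snd e) \<in> arcs (cycle_graph n)" "cyc_dist n (snd e) v \<le> length p"
      by (auto simp: awalk_Cons_iff ends)
    with cyc_dist_arc[OF _ assms(3)] show ?case by fastforce
  qed
  have upper: "\<exists>p. awalk u p v \<and> length p = d" if "u < n" "cyc_dist n u v = d" for u d
    using that
  proof (induction d arbitrary: u)
    case 0
    then have "u = v"
      using assms(3) by (auto simp: cyc_dist_def Let_def min_def split: if_splits)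
    with 0 have "awalk u [] v" by (simp add: awalk_Nil_iff verts)
    then show ?case by force
  next
    case (Suc d)
    then have "u \<noteq> v" by (auto simp: cyc_dist_def)
    then obtain u' where u': "(u, u') \<in> arcs (cycle_graph n)" "Suc (cyc_dist n u' v) = cyc_dist n u v"
      using cyc_dist_decrease Suc.prems(1) assms(3) by metis
    from u'(1) have "u' < n" by (simp add: cycle_graph_def)
    with Suc u' obtain p where "awalk u' p v" "length p = d" by auto
    with u'(1) have "awalk u ((u, u') # p) v" "length ((u, u') # p) = Suc d"
      by (simp_all add: awalk_Cons_iff ends)
    then show ?case by blast
  qed
  obtain p where "awalk u p v" "length p = cyc_dist n u v"
    using upper assms by blast
  then show ?thesis
    unfolding graph_dist_def \<mu>_def
    by (intro antisym INF_greatest INF_lower2[of p]) (auto simp: awalk_cost_one lower)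
qed

section \<open>Representations with natural-number distances\<close>

definition cyc_rep :: "nat \<Rightarrow> nat set set \<Rightarrow> nat \<Rightarrow> nat multiset" where
  "cyc_rep n P v = image_mset (\<lambda>S. Min (cyc_dist n v ` S)) (mset_set P)"

text \<open>The embedding of \<open>nat\<close> into \<open>ereal\<close> is monotone, so it
  commutes with the minimum over a part.\<close>

lemma mp_representation_cycle_graph:
  assumes "n \<ge> 3" "partition_on {0..<n} P" "v < n"
  shows "mp_representation (cycle_graph n) P v = image_mset (ereal \<circ> real) (cyc_rep n P v)"
proof -
  have "dist_to_set (cycle_graph n) v S = ereal (real (Min (cyc_dist n v ` S)))" if "S \<in> P" for S
  proof -
    have S: "S \<subseteq> {0..<n}" "finite S" "S \<noteq> {}"
      using that assms(2) by (auto simp: partition_on_def intro: finite_subset)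
    then have "graph_dist (cycle_graph n) v ` S = (\<lambda>x. ereal (real x)) ` cyc_dist n v ` S"
      unfolding image_image using assms
      by (intro image_cong) (auto simp: graph_dist_cycle_graph)
    moreover have "mono (\<lambda>x. ereal (real x))" by (auto intro!: monoI)
    ultimately show ?thesis
      using mono_Min_commute[of "\<lambda>x. ereal (real x)" "cyc_dist n v ` S"] S
      by (simp add: dist_to_set_def)
  qed
  moreover have "finite P" using assms(2) finite_elements by blast
  ultimately show ?thesis
    by (auto simp: mp_representation_def cyc_rep_def multiset.map_comp intro!: image_mset_cong)
qed

text \<open>The embedding is also injective, hence so is its action on multisets, and
  representations can be compared over \<open>nat\<close>.\<close>

lemma resolving_cycle_graph_iff:
  assumes "n \<ge> 3"
  shows "resolving_multiset_partition (cycle_graph n) P \<longleftrightarrow>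
    partition_on {0..<n} P \<and> inj_on (cyc_rep n P) {0..<n}"
proof -
  have "inj (ereal \<circ> real)" by (auto intro!: injI)
  then have "image_mset (ereal \<circ> real) A = image_mset (ereal \<circ> real) B \<longleftrightarrow> A = B" for A B
    using multiset.inj_map[of "ereal \<circ> real"] by (auto dest: injD)
  then have eq: "mp_representation (cycle_graph n) P u = mp_representation (cycle_graph n) P v \<longleftrightarrow>
      cyc_rep n P u = cyc_rep n P v"
    if "partition_on {0..<n} P" "u \<in> {0..<n}" "v \<in> {0..<n}" for u v
    using that by (simp add: mp_representation_cycle_graph assms)
  have "verts (cycle_graph n) = {0..<n}" by (simp add: cycle_graph_def)
  then show ?thesis
    unfolding resolving_multiset_partition_def inj_on_def
    using eq by metis
qed

lemma mpd_eqI: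
  assumes "resolving_multiset_partition G P" "card P = k"
    and "\<And>Q. resolving_multiset_partition G Q \<Longrightarrow> k \<le> card Q"
  shows "mpd G = enat k"
  unfolding mpd_def using assms by (intro antisym Inf_lower Inf_greatest) auto

section \<open>Searching all partitions of small cycles\<close>

text \<open>Sending each element to its block maps \<open>A\<close> onto \<open>P\<close>. This
  makes a search bounded by the number of vertices exhaustive.\<close>

lemma card_partition_on_le:
  assumes "partition_on A P" "finite A"
  shows "card P \<le> card A"
proof -
  have "P \<subseteq> (\<lambda>x. THE S. S \<in> P \<and> x \<in> S) ` A"
  proof
    fix S assume S: "S \<in> P"
    then obtain x where x: "x \<in> S" using assms(1) by (metis partition_on_def ex_in_conv)
    then have "(THE S. S \<in> P \<and> x \<in> S) = S"
      using S assms(1) by (intro the_equality) (auto simp: partition_on_def disjoint_def)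
    moreover have "x \<in> A" using x S assms(1) by (auto simp: partition_on_def)
    ultimately show "S \<in> (\<lambda>x. THE S. S \<in> P \<and> x \<in> S) ` A" by force
  qed
  then show ?thesis
    using assms(2) by (meson card_image_le card_mono finite_imageI le_trans)
qed

text \<open>
  During the search a block \<open>S\<close> is represented only by its list of distances to all vertices, see
  \<open>dist_row\<close> below; enlarging the block by a vertex is then a pointwise minimum. The enumeration is
  in continuation-passing style so that rewriting visits one partition at a time: rewriting with an
  explicit list of all partitions would traverse that list again at every step.
\<close>

fun merge_row :: "nat list \<Rightarrow> nat list list \<Rightarrow> nat list list list" where
  "merge_row r [] = []"
| "merge_row r (s # p) = (map2 min r s # p) # map ((#) s) (merge_row r p)"

fun all_partitions :: "nat \<Rightarrow> nat list list \<Rightarrow> (nat list list \<Rightarrow> bool) \<Rightarrow> bool" where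
  "all_partitions k [] T = T []"
| "all_partitions k (r # rs) T =
     all_partitions k rs
       (\<lambda>p. (if length p < k then T (r # p) else True) \<and> list_all T (merge_row r p))"

text \<open>Entry \<open>v\<close> collects the \<open>v\<close>-th coordinates of all rows. Keeping
  it sorted makes equal multisets visible as equal lists, so \<open>distinct\<close> can test for a
  repetition.\<close>

definition row_reps :: "nat \<Rightarrow> nat list list \<Rightarrow> nat list list" where
  "row_reps n p = foldr (map2 insort) p (replicate n [])"

definition dist_row :: "nat \<Rightarrow> nat set \<Rightarrow> nat list" where
  "dist_row n S = map (\<lambda>v. Min (cyc_dist n v ` S)) [0..<n]"

text \<open>The search lists blocks in an order of its own, so its results are matched with a set of
  blocks only up to multiset equality.\<close>

lemma merge_row_mset:
  assumes "s \<in> set p"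
  shows "\<exists>q \<in> set (merge_row r p). mset q = add_mset (map2 min r s) (mset p - {#s#})"
  using assms
proof (induction p)
  case Nil
  then show ?case by simp
next
  case (Cons t p)
  show ?case
  proof (cases "s = t")
    case True
    then show ?thesis by simp
  next
    case False
    with Cons obtain q where "q \<in> set (merge_row r p)"
      "mset q = add_mset (map2 min r s) (mset p - {#s#})" by auto
    with False show ?thesis
      by (intro bexI[of _ "t # q"]) (auto simp: add_mset_commute)
  qed
qed

lemma dist_row_insert:
  assumes "finite S" "S \<noteq> {}"
  shows "dist_row n (insert m S) = map2 min (dist_row n {m}) (dist_row n S)"
  using assms by (simp add: dist_row_def map2_map_map)

text \<open>Induction removes the last vertex \<open>m\<close>: it either forms a block alone or was
  added to a block of a partition of the smaller vertices. The cycle length \<open>n\<close> stays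
  fixed, so rows always list distances in the full cycle.\<close>

lemma all_partitions_sound:
  assumes "all_partitions k (map (\<lambda>u. dist_row n {u}) (rev [0..<m])) T"
    and "partition_on {0..<m} P" "card P \<le> k"
  obtains p where "T p" "mset p = image_mset (dist_row n) (mset_set P)"
proof -
  have "\<exists>p. T p \<and> mset p = image_mset (dist_row n) (mset_set P)"
    using assms
  proof (induction m arbitrary: T P)
    case 0
    then show ?case by (simp add: partition_on_empty)
  next
    case (Suc m)
    \<comment> \<open>The continuation handed to the search on the smaller vertices; the induction
      hypothesis must therefore hold for every \<open>T\<close>.\<close>
    let ?T = "\<lambda>p. (if length p < k then T (dist_row n {m} # p) else True) \<and>
                list_all T (merge_row (dist_row n {m}) p)"
    have T: "all_partitions k (map (\<lambda>u. dist_row n {u}) (rev [0..<m])) ?T"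
      using Suc.prems(1) by simp
    have fin: "finite P" using Suc.prems(2) finite_elements by blast
    obtain S where S: "S \<in> P" "m \<in> S"
      by (metis Suc.prems(2) UnionE atLeastLessThan_iff lessI partition_onD1 zero_le)
    define Q where "Q = P - {S}"
    have P: "P = insert S Q" "S \<notin> Q" "finite Q" using S fin by (auto simp: Q_def)
    have disj: "disjnt S (\<Union>Q)"
      using Suc.prems(2) P by (auto simp: partition_on_def disjoint_def disjnt_def)
    then have Q: "partition_on ({0..<Suc m} - S) Q" and S_sub: "S \<subseteq> {0..<Suc m}"
      using Suc.prems(2) P partition_on_insert by blast+
    show ?case
    proof (cases "S = {m}")
      case True
      then have "{0..<Suc m} - S = {0..<m}" by auto
      with Q have "partition_on {0..<m} Q" by simp
      moreover have "card Q < k" using Suc.prems(3) P by simp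
      ultimately obtain p where p: "?T p" "mset p = image_mset (dist_row n) (mset_set Q)"
        using Suc.IH[OF T] by (metis less_imp_le)
      have "length p = card Q" using p(2) by (metis size_image_mset size_mset size_mset_set)
      with p \<open>card Q < k\<close> have "T (dist_row n {m} # p)" by simp
      moreover have "mset (dist_row n {m} # p) = image_mset (dist_row n) (mset_set P)"
        using p(2) P True by simp
      ultimately show ?thesis by blast
    next
      case False
      \<comment> \<open>Replacing \<open>S\<close> by the nonempty \<open>R\<close> keeps the number
        of blocks, so the bound \<open>k\<close> still holds for the smaller partition.\<close>
      define R where "R = S - {m}"
      have R: "S = insert m R" "m \<notin> R" "R \<noteq> {}" "finite R"
        using False S S_sub by (auto simp: R_def intro: finite_subset)
      have "disjnt R (\<Union>Q)" using disj R by (auto simp: disjnt_def)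
      have "{0..<Suc m} - S = {0..<m} - R" using R by auto
      moreover have "R \<subseteq> {0..<m}" using R S_sub by (auto simp: less_Suc_eq)
      ultimately have "partition_on {0..<m} (insert R Q)"
        using Q R(3) partition_on_insert[OF \<open>disjnt R (\<Union>Q)\<close>] by simp
      moreover have "R \<notin> Q" using \<open>disjnt R (\<Union>Q)\<close> R by (auto simp: disjnt_def)
      moreover have "card (insert R Q) \<le> k"
        using Suc.prems(3) P \<open>R \<notin> Q\<close> by simp
      ultimately obtain p where p: "?T p" "mset p = image_mset (dist_row n) (mset_set (insert R Q))"
        using Suc.IH[OF T] by blast
      from p(2) P \<open>R \<notin> Q\<close> have mset_p: "mset p = add_mset (dist_row n R) (image_mset (dist_row n) (mset_set Q))"
        by simp
      then have "dist_row n R \<in> set p" by (metis set_mset_mset union_single_eq_member)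
      then obtain q where q: "q \<in> set (merge_row (dist_row n {m}) p)"
        "mset q = add_mset (map2 min (dist_row n {m}) (dist_row n R)) (mset p - {#dist_row n R#})"
        using merge_row_mset by blast
      have "mset q = image_mset (dist_row n) (mset_set P)"
        using q(2) mset_p P R dist_row_insert[of R n m] by simp
      moreover have "T q" using p(1) q(1) by (simp add: list_all_iff)
      ultimately show ?thesis by blast
    qed
  qed
  with that show thesis by blast
qed

lemma row_reps_nth:
  assumes "\<And>r. r \<in> set p \<Longrightarrow> length r = n"
  shows "length (row_reps n p) = n \<and>
    (\<forall>v<n. mset (row_reps n p ! v) = image_mset (\<lambda>r. r ! v) (mset p))"
  using assms by (induction p) (auto simp: row_reps_def)

lemma not_inj_on_cyc_rep_by_search:
  assumes "all_partitions k (map (\<lambda>u. map (cyc_dist n u) [0..<n]) (rev [0..<n]))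
      (\<lambda>p. \<not> distinct (row_reps n p))"
    and "partition_on {0..<n} P" "card P \<le> k"
  shows "\<not> inj_on (cyc_rep n P) {0..<n}"
proof -
  \<comment> \<open>By symmetry of the distance, the rows fed to the search, written without
    \<open>Min\<close>, are those of singleton blocks.\<close>
  have "map (cyc_dist n u) [0..<n] = dist_row n {u}" for u
    by (simp add: dist_row_def cyc_dist_commute)
  with assms obtain p where p: "\<not> distinct (row_reps n p)"
    "mset p = image_mset (dist_row n) (mset_set P)"
    by (auto elim: all_partitions_sound)
  have "finite P" using assms(2) finite_elements by blast
  then have "set p = dist_row n ` P" using p(2) by (metis finite_set_mset_mset_set set_image_mset set_mset_mset)
  then have "length r = n" if "r \<in> set p" for r using that by (auto simp: dist_row_def)
  note reps = row_reps_nth[OF this]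
  have rep: "mset (row_reps n p ! v) = cyc_rep n P v" if "v < n" for v
    using that reps by (auto simp: p(2) cyc_rep_def multiset.map_comp dist_row_def intro!: image_mset_cong)
  obtain u v where "u < n" "v < n" "u \<noteq> v" "row_reps n p ! u = row_reps n p ! v"
    using p(1) reps by (auto simp: distinct_conv_nth)
  then show ?thesis using rep by (metis atLeast0LessThan inj_onD lessThan_iff)
qed

text \<open>With bound \<open>n\<close> the search covers every partition, so these cycles have no
  resolving partition at all.\<close>

lemma search_three_to_seven_vertices:
  "list_all (\<lambda>n. all_partitions n (map (\<lambda>u. map (cyc_dist n u) [0..<n]) (rev [0..<n]))
    (\<lambda>p. \<not> distinct (row_reps n p))) [3, 4, 5, 6, 7]"
  by code_simp

lemma search_eight_vertices:
  "all_partitions 4 (map (\<lambda>u. map (cyc_dist 8 u) [0..<8]) (rev [0..<8]))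
    (\<lambda>p. \<not> distinct (row_reps 8 p))"
  by code_simp

section \<open>A resolving partition of the 8-cycle into five parts\<close>

text \<open>Once the parts are known to be pairwise distinct, the set unfolds to a multiset whose
  entries can be mapped and counted.\<close>

lemma mset_set_five_parts:
  "mset_set {{0}, {1}, {3}, {5}, {2, 4, 6, 7::nat}} = {#{0}, {1}, {3}, {5}, {2, 4, 6, 7}#}"
proof -
  have "{3} \<noteq> {2, 4, 6, 7::nat}" "{5} \<noteq> {2, 4, 6, 7::nat}" "{1} \<noteq> {2, 4, 6, 7::nat}"
    "{0} \<noteq> {2, 4, 6, 7::nat}"
    by (auto dest!: equalityD2)
  then show ?thesis by simp
qed

lemma inj_on_cyc_rep_five_parts:
  "inj_on (cyc_rep 8 {{0}, {1}, {3}, {5}, {2, 4, 6, 7}}) {0..<8}"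
proof -
  let ?P = "{{0}, {1}, {3}, {5}, {2, 4, 6, 7::nat}}" and ?g = "\<lambda>M. \<Sum>d\<in>#M. (5::nat) ^ d"
  \<comment> \<open>Any function of the multiset that separates the eight vertices will do.\<close>
  have "?g (cyc_rep 8 ?P v) = (\<Sum>S\<leftarrow>[[0], [1], [3], [5], [2, 4, 6, 7]]. 5 ^ Min (set (map (cyc_dist 8 v) S)))"
    for v
    by (simp add: cyc_rep_def mset_set_five_parts)
  moreover have "distinct (map (\<lambda>v. \<Sum>S\<leftarrow>[[0], [1], [3], [5], [2, 4, 6, 7]].
      (5::nat) ^ Min (set (map (cyc_dist 8 v) S))) [0..<8])"
    by code_simp
  ultimately have "distinct (map (\<lambda>v. ?g (cyc_rep 8 ?P v)) [0..<8])" by simp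
  then have "inj_on (?g \<circ> cyc_rep 8 ?P) {0..<8}" by (simp add: distinct_map comp_def)
  \<comment> \<open>Injectivity of a composition passes to the map applied first.\<close>
  then show ?thesis by (rule inj_on_imageI2)
qed

section \<open>Three parts do not suffice\<close>

text \<open>The least possible \<open>m\<close> is taken over all left ends, so the new
  \<open>a\<close> may differ from the given one. If the colour of an end point recurred on the arc,
  deleting that end point would leave a shorter arc with all colours.\<close>

lemma ex_shortest_arc:
  fixes c :: "int \<Rightarrow> 'c"
  assumes "c ` {a..a + int l} = C" "card C = k" "k \<ge> 2"
  obtains a m where "m \<le> l" "c ` {a..a + int m} = C"
    "\<And>b j. j < m \<Longrightarrow> c ` {b..b + int j} \<noteq> C" "m > 0"
    "\<And>x. a < x \<Longrightarrow> x \<le> a + int m \<Longrightarrow> c x \<noteq> c a"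
    "\<And>x. a \<le> x \<Longrightarrow> x < a + int m \<Longrightarrow> c x \<noteq> c (a + int m)"
proof -
  define m where "m = (LEAST m. \<exists>a. c ` {a..a + int m} = C)"
  have ex: "\<exists>m a. c ` {a..a + int m} = C" using assms(1) by blast
  obtain a where a: "c ` {a..a + int m} = C"
    unfolding m_def using LeastI_ex[OF ex] by blast
  have least: "m \<le> j" if "c ` {b..b + int j} = C" for b j
    unfolding m_def using that by (intro Least_le) blast
  have "m \<noteq> 0"
  proof
    assume "m = 0"
    with a have "C = {c a}" by auto
    with assms(2,3) show False by simp
  qed
  show thesis
  proof (rule that[OF _ a])
    show "m \<le> l" using least assms(1) by blast
    show "c ` {b..b + int j} \<noteq> C" if "j < m" for b j using least[of b j] that by linarith
    show "m > 0" using \<open>m \<noteq> 0\<close> by simp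
    show "c x \<noteq> c a" if x: "a < x" "x \<le> a + int m" for x
    proof
      assume eq: "c x = c a"
      have "{a..a + int m} = insert a {a + 1..a + 1 + int (m - 1)}"
        using \<open>m \<noteq> 0\<close> by (auto simp: of_nat_diff)
      moreover have "x \<in> {a + 1..a + 1 + int (m - 1)}"
        using x by (auto simp: of_nat_diff)
      ultimately have "c ` {a + 1..a + 1 + int (m - 1)} = C"
        using a eq by (metis image_eqI image_insert insert_absorb)
      from least[OF this] show False using \<open>m \<noteq> 0\<close> by simp
    qed
    show "c x \<noteq> c (a + int m)" if x: "a \<le> x" "x < a + int m" for x
    proof
      assume eq: "c x = c (a + int m)"
      have "{a..a + int m} = insert (a + int m) {a..a + int (m - 1)}"
        using \<open>m \<noteq> 0\<close> by (auto simp: of_nat_diff)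
      moreover have "x \<in> {a..a + int (m - 1)}"
        using x by (auto simp: of_nat_diff)
      ultimately have "c ` {a..a + int (m - 1)} = C"
        using a eq by (metis image_eqI image_insert insert_absorb)
      from least[OF this] show False using \<open>m \<noteq> 0\<close> by simp
    qed
  qed
qed

section \<open>The cycle as the integers modulo \<open>n\<close>\<close>

text \<open>The difference \<open>y - x\<close> equals \<open>v - u\<close> up to a multiple of
  \<open>n\<close>: a zero multiple is the direct way, and any other forces at least the length of
  the way round.\<close>

lemma cyc_dist_mod_le:
  assumes "n > 0"
  shows "cyc_dist n (nat (x mod int n)) (nat (y mod int n)) \<le> nat \<bar>y - x\<bar>"
proof -
  define u v k where "u = x mod int n" and "v = y mod int n" and "k = y div int n - x div int n"
  have uv: "0 \<le> u" "u < int n" "0 \<le> v" "v < int n" using assms by (simp_all add: u_def v_def)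
  have "x = u + x div int n * int n" "y = v + y div int n * int n" by (simp_all add: u_def v_def)
  then have "y - x = v - u + k * int n" by (simp add: k_def algebra_simps)
  \<comment> \<open>Linear arithmetic can now treat the product \<open>k * int n\<close> as a single
    unknown.\<close>
  moreover have "k * int n = 0 \<or> k * int n \<ge> int n \<or> k * int n \<le> - int n"
  proof -
    consider "k = 0" | "k \<ge> 1" | "k \<le> -1" by linarith
    then show ?thesis
    proof cases
      case 2
      then show ?thesis using mult_right_mono[of 1 k "int n"] by simp
    next
      case 3
      then show ?thesis using mult_right_mono[of k "-1" "int n"] by simp
    qed simp
  qed
  ultimately have "\<bar>y - x\<bar> \<ge> \<bar>v - u\<bar> \<or> \<bar>y - x\<bar> \<ge> int n - \<bar>v - u\<bar>"
    using uv by linarith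
  moreover have "int (cyc_dist n (nat u) (nat v)) = min \<bar>v - u\<bar> (int n - \<bar>v - u\<bar>)"
    using uv int_cyc_dist[of "nat u" n "nat v"] by (simp add: nat_less_iff abs_minus_commute)
  ultimately have "int (cyc_dist n (nat u) (nat v)) \<le> \<bar>y - x\<bar>" by linarith
  then show ?thesis by (simp add: u_def v_def)
qed

text \<open>One of the two directions reaches \<open>v\<close> after \<open>d\<close> steps; the
  four equations in the proof distinguish the direction and whether it wraps around.\<close>

lemma cyc_dist_mod_attained:
  fixes x :: int
  assumes "v < n"
  defines "d \<equiv> int (cyc_dist n (nat (x mod int n)) v)"
  shows "(x + d) mod int n = int v \<or> (x - d) mod int n = int v"
proof -
  define u where "u = nat (x mod int n)"
  have "u < n" and u: "int u = x mod int n" using assms(1) by (auto simp: u_def nat_less_iff)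
  have "int v + d = int u \<or> int v - d = int u \<or> int v + d = int u + int n \<or> int v - d = int u - int n"
  proof (cases "u \<le> v")
    case True
    then have "d = int v - int u \<or> d = int n - (int v - int u)"
      using \<open>u < n\<close> assms by (auto simp: d_def u_def[symmetric] cyc_dist_def Let_def min_def of_nat_diff)
    then show ?thesis by linarith
  next
    case False
    then have "d = int u - int v \<or> d = int n - (int u - int v)"
      using \<open>u < n\<close> assms by (auto simp: d_def u_def[symmetric] cyc_dist_def Let_def min_def of_nat_diff)
    then show ?thesis by linarith
  qed
  moreover have "int u mod int n = x mod int n" "(int u + int n) mod int n = x mod int n"
    "(int u - int n) mod int n = x mod int n"
    using u by simp_all
  ultimately have "x mod int n = (int v - d) mod int n \<or> x mod int n = (int v + d) mod int n"
    by metis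
  then show ?thesis
  proof
    assume "x mod int n = (int v - d) mod int n"
    then have "(x + d) mod int n = (int v - d + d) mod int n" by (metis mod_add_left_eq)
    then show ?thesis using assms(1) by simp
  next
    assume "x mod int n = (int v + d) mod int n"
    then have "(x - d) mod int n = (int v + d - d) mod int n" by (metis mod_diff_left_eq)
    then show ?thesis using assms(1) by simp
  qed
qed

text \<open>
  On a shortest arc \<open>a, \<dots>, a + m\<close> meeting all three colours the end points have private colours, so
  all interior vertices share the third one. For \<open>m \<ge> 3\<close> the two outermost interior vertices both have
  distances \<open>0, 1, m - 1\<close>: a shorter way to the far colour would give a shorter arc. For \<open>m = 2\<close> the
  three vertices of the arc have distances \<open>0, 1, x\<close> with \<open>x \<in> {1, 2}\<close>, so two of them agree.
\<close>

lemma colouring_with_three_colours_not_resolving: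
  fixes c :: "int \<Rightarrow> 'c" and D :: "'c \<Rightarrow> int \<Rightarrow> nat" and n :: nat
  assumes n: "n \<ge> 3" and C: "c ` {0..<int n} = C" "card C \<le> 3" and c_in: "\<And>x. c x \<in> C"
    and D_le: "\<And>x y. D (c y) x \<le> nat \<bar>y - x\<bar>"
    and D_attained: "\<And>S x. S \<in> C \<Longrightarrow> c (x + int (D S x)) = S \<or> c (x - int (D S x)) = S"
  shows "\<exists>x y. x mod int n \<noteq> y mod int n \<and>
    image_mset (\<lambda>S. D S x) (mset_set C) = image_mset (\<lambda>S. D S y) (mset_set C)"
proof -
  have fin: "finite C" using C(1) by auto
  have "c 0 \<in> C" using C(1) n by force
  then have "card C \<noteq> 0" using fin by auto
  have near: "1 mod int n = 1" "(x + 1) mod int n \<noteq> x mod int n" "(x + 2) mod int n \<noteq> x mod int n" for x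
  proof -
    show "1 mod int n = 1" using n by simp
    have "\<not> int n dvd 1" "\<not> int n dvd 2" using n zdvd_imp_le[of "int n"] by fastforce+
    then show "(x + 1) mod int n \<noteq> x mod int n" "(x + 2) mod int n \<noteq> x mod int n"
      by (auto simp: mod_eq_dvd_iff)
  qed
  have D_self: "D (c x) x = 0" for x using D_le[of x x] by simp
  have D_pos: "D S x > 0" if "S \<in> C" "c x \<noteq> S" for S x
    using D_attained[OF that(1), of x] that(2) by (cases "D S x") auto
  have D_next: "D (c y) x = 1" if "c y \<in> C" "c y \<noteq> c x" "\<bar>y - x\<bar> = 1" for x y
    using D_le[of y x] D_pos[of "c y" x] that by auto
  consider "card C = 1" | "card C = 2" | "card C = 3"
    using \<open>card C \<noteq> 0\<close> C(2) by linarith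
  then show ?thesis
  proof cases
    \<comment> \<open>With one colour every vertex has the single distance \<open>0\<close>.\<close>
    case 1
    then have C0: "C = {c 0}" using \<open>c 0 \<in> C\<close> by (auto simp: card_1_singleton_iff)
    have "c 1 \<in> C" using C(1) n by force
    then have "c 1 = c 0" using C0 by simp
    then have "D (c 0) 1 = D (c 0) 0" using D_self[of 1] D_self[of 0] by simp
    then show ?thesis using C0 near by (intro exI[of _ 0] exI[of _ 1]) simp
  next
    \<comment> \<open>With two colours, the left end of a shortest arc and its right neighbour are
      coloured differently, and both have the distances \<open>0\<close> and
      \<open>1\<close>.\<close>
    case 2
    have arc: "c ` {0..0 + int (n - 1)} = C"
      using C(1) n by (simp add: of_nat_diff atLeastLessThanPlusOne_atLeastAtMost_int[symmetric])
    obtain a m where m: "c ` {a..a + int m} = C" "m > 0"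
      "\<And>x. a < x \<Longrightarrow> x \<le> a + int m \<Longrightarrow> c x \<noteq> c a"
      "\<And>x. a \<le> x \<Longrightarrow> x < a + int m \<Longrightarrow> c x \<noteq> c (a + int m)"
      by (rule ex_shortest_arc[OF arc 2]) auto
    have mem: "c x \<in> C" if "a \<le> x" "x \<le> a + int m" for x using m(1) that by auto
    have neq: "c a \<noteq> c (a + int m)" using m by auto
    have "C = {c a, c (a + int m)}"
      using 2 neq mem[of a] mem[of "a + int m"] fin
      by (intro card_seteq[symmetric]) auto
    moreover have "c (a + 1) \<in> C" using mem m(2) by auto
    ultimately have "c (a + 1) = c (a + int m)" using m(2) m(3)[of "a + 1"] by auto
    then have C2: "C = {c a, c (a + 1)}" "c a \<noteq> c (a + 1)" using \<open>C = _\<close> neq by simp_all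
    have "D (c (a + 1)) a = 1" "D (c a) (a + 1) = 1"
      using D_next[of "a + 1" a] D_next[of a "a + 1"] C2 by auto
    then show ?thesis
      using C2 near(2)[of a] D_self[of a] D_self[of "a + 1"]
      by (intro exI[of _ "a + 1"] exI[of _ a]) simp
  next
    case 3
    have arc: "c ` {0..0 + int (n - 1)} = C"
      using C(1) n by (simp add: of_nat_diff atLeastLessThanPlusOne_atLeastAtMost_int[symmetric])
    obtain a m where "m \<le> n - 1" and m: "c ` {a..a + int m} = C" "m > 0"
      "\<And>b j. j < m \<Longrightarrow> c ` {b..b + int j} \<noteq> C"
      "\<And>x. a < x \<Longrightarrow> x \<le> a + int m \<Longrightarrow> c x \<noteq> c a"
      "\<And>x. a \<le> x \<Longrightarrow> x < a + int m \<Longrightarrow> c x \<noteq> c (a + int m)"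
      by (rule ex_shortest_arc[OF arc 3]) auto
    define A B E where "A = c a" and "B = c (a + 1)" and "E = c (a + int m)"
    have mem: "c x \<in> C" if "a \<le> x" "x \<le> a + int m" for x using m(1) that by auto
    have "A \<noteq> E" using m by (auto simp: A_def E_def)
    have "m \<noteq> 1"
    proof
      assume "m = 1"
      moreover have "{a..a + 1} = {a, a + 1}" by auto
      ultimately have "C = {A, E}" using m(1) by (auto simp: A_def E_def)
      then show False using 3 \<open>A \<noteq> E\<close> by simp
    qed
    with m(2) have "m \<ge> 2" by linarith
    then have "A \<noteq> B" "B \<noteq> E"
      using m(4)[of "a + 1"] m(5)[of "a + 1"] by (auto simp: A_def B_def E_def)
    have "{A, B, E} \<subseteq> C" using mem \<open>m \<ge> 2\<close> by (auto simp: A_def B_def E_def)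
    then have C3: "C = {A, B, E}"
      using 3 \<open>A \<noteq> E\<close> \<open>A \<noteq> B\<close> \<open>B \<noteq> E\<close> fin by (intro card_seteq[symmetric]) auto
    have inner: "c x = B" if "a < x" "x < a + int m" for x
      using mem[of x] m(4)[of x] m(5)[of x] that unfolding C3 by (auto simp: A_def E_def)
    have mset_C: "mset_set C = {#A, B, E#}"
      using C3 \<open>A \<noteq> E\<close> \<open>A \<noteq> B\<close> \<open>B \<noteq> E\<close> by simp
    have D_A: "D A (a + 1) = 1" and D_E: "D E (a + int m - 1) = 1"
      using D_next[of a "a + 1"] D_next[of "a + int m" "a + int m - 1"]
        inner[of "a + 1"] inner[of "a + int m - 1"] \<open>m \<ge> 2\<close> C3 \<open>A \<noteq> B\<close> \<open>B \<noteq> E\<close>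
      by (auto simp: A_def E_def)
    show ?thesis
    proof (cases "m = 2")
      case True
      have "D B a = 1" "D B (a + 2) = 1" "D E (a + 1) = 1"
        using D_next[of "a + 1" a] D_next[of "a + 1" "a + 2"] D_next[of "a + 2" "a + 1"]
          C3 True \<open>A \<noteq> B\<close> \<open>B \<noteq> E\<close>
        by (auto simp: A_def B_def E_def)
      moreover have "D A a = 0" "D B (a + 1) = 0" "D E (a + 2) = 0"
        using D_self True by (auto simp: A_def B_def E_def)
      moreover have "D E a \<in> {1, 2}" "D A (a + 2) \<in> {1, 2}"
        using D_le[of "a + 2" a] D_pos[of E a] D_le[of a "a + 2"] D_pos[of A "a + 2"]
          C3 True \<open>A \<noteq> E\<close> by (auto simp: A_def E_def)
      \<comment> \<open>The middle vertex has \<open>0, 1, 1\<close>. An end at distance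
        \<open>1\<close> from the opposite end's colour agrees with it; otherwise both ends have
        \<open>0, 1, 2\<close>.\<close>
      ultimately consider "image_mset (\<lambda>S. D S a) (mset_set C) = image_mset (\<lambda>S. D S (a + 1)) (mset_set C)"
        | "image_mset (\<lambda>S. D S (a + 2)) (mset_set C) = image_mset (\<lambda>S. D S (a + 1)) (mset_set C)"
        | "image_mset (\<lambda>S. D S (a + 2)) (mset_set C) = image_mset (\<lambda>S. D S a) (mset_set C)"
        using D_A by (auto simp: mset_C add_mset_commute)
      then show ?thesis
        using near(2)[of a] near(3)[of a] near(2)[of "a + 1"] by (metis add.assoc one_add_one)
    next
      case False
      then have "m \<ge> 3" using \<open>m \<ge> 2\<close> by linarith
      have short: False
        if "c x = A" "c y = B" "c z = E" "{x, y, z} \<subseteq> {b..b + int j}" "j < m" for x y z b j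
      proof -
        have "{A, B, E} \<subseteq> c ` {b..b + int j}" using that by blast
        moreover have "c ` {b..b + int j} \<subseteq> C" using c_in by blast
        ultimately show False using m(3)[OF \<open>j < m\<close>, of b] C3 by (metis subset_antisym)
      qed
      have D_E': "D E (a + 1) = m - 1"
      proof (rule antisym)
        show "D E (a + 1) \<le> m - 1" using D_le[of "a + int m" "a + 1"] \<open>m \<ge> 3\<close> by (simp add: E_def)
        show "m - 1 \<le> D E (a + 1)"
        proof (rule ccontr)
          define j where "j = D E (a + 1)"
          assume "\<not> m - 1 \<le> D E (a + 1)"
          then have "j < m - 1" by (simp add: j_def)
          have "j > 0" unfolding j_def using D_pos[of E "a + 1"] \<open>B \<noteq> E\<close> C3 by (auto simp: B_def)
          \<comment> \<open>The vertex \<open>j\<close> steps to the right is still interior, so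
            colour \<open>E\<close> must occur \<open>j\<close> steps to the left. Since
            \<open>j > 0\<close>, the stretch from there to \<open>a + 1\<close> contains
            \<open>a\<close> and meets all three colours.\<close>
          have "c (a + 1 + int j) = B" using inner[of "a + 1 + int j"] \<open>j < m - 1\<close> by auto
          then have "c (a + 1 - int j) = E"
            using D_attained[of E "a + 1"] C3 \<open>B \<noteq> E\<close> by (auto simp: j_def)
          with \<open>j > 0\<close> \<open>j < m - 1\<close> show False
            by (intro short[of a "a + 1" "a + 1 - int j" "a + 1 - int j" j]) (auto simp: A_def B_def)
        qed
      qed
      have D_A': "D A (a + int m - 1) = m - 1"
      proof (rule antisym)
        show "D A (a + int m - 1) \<le> m - 1" using D_le[of a "a + int m - 1"] \<open>m \<ge> 3\<close> by (simp add: A_def)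
        show "m - 1 \<le> D A (a + int m - 1)"
        proof (rule ccontr)
          define j where "j = D A (a + int m - 1)"
          assume "\<not> m - 1 \<le> D A (a + int m - 1)"
          then have "j < m - 1" by (simp add: j_def)
          have B: "c (a + int m - 1) = B" using inner \<open>m \<ge> 3\<close> by simp
          have "j > 0" unfolding j_def using D_pos[of A "a + int m - 1"] \<open>A \<noteq> B\<close> B C3 by auto
          \<comment> \<open>The mirror image: colour \<open>A\<close> must occur to the right,
            beyond the end \<open>a + int m\<close> of colour \<open>E\<close>.\<close>
          have "c (a + int m - 1 - int j) = B" using inner[of "a + int m - 1 - int j"] \<open>j < m - 1\<close> by auto
          then have "c (a + int m - 1 + int j) = A"
            using D_attained[of A "a + int m - 1"] C3 \<open>A \<noteq> B\<close> by (auto simp: j_def)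
          with \<open>j > 0\<close> \<open>j < m - 1\<close> B show False
            by (intro short[of "a + int m - 1 + int j" "a + int m - 1" "a + int m" "a + int m - 1" j])
              (auto simp: E_def)
        qed
      qed
      have "D B (a + 1) = 0" "D B (a + int m - 1) = 0"
        using D_self[of "a + 1"] D_self[of "a + int m - 1"] inner[of "a + int m - 1"] \<open>m \<ge> 3\<close>
        by (auto simp: B_def)
      with D_A D_E D_A' D_E' have
        "image_mset (\<lambda>S. D S (a + 1)) (mset_set C) = image_mset (\<lambda>S. D S (a + int m - 1)) (mset_set C)"
        by (simp add: mset_C add_mset_commute)
      \<comment> \<open>The two vertices are \<open>m - 2\<close> apart, and
        \<open>0 < m - 2 < n\<close> because the arc makes less than a full turn.\<close>
      moreover have "\<not> int n dvd int (m - 2)"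
        using \<open>m \<ge> 3\<close> \<open>m \<le> n - 1\<close> by (intro notI) (auto dest!: zdvd_imp_le)
      then have "(a + 1) mod int n \<noteq> (a + int m - 1) mod int n"
        using \<open>m \<ge> 3\<close> by (auto simp: mod_eq_dvd_iff of_nat_diff algebra_simps dvd_diff_commute)
      ultimately show ?thesis by blast
    qed
  qed
qed

text \<open>Each integer is coloured by the part containing its residue. Intervals on the line then
  stand for arcs, including those that pass through vertex \<open>0\<close>.\<close>

lemma not_inj_on_cyc_rep_three:
  assumes "n \<ge> 3" "partition_on {0..<n} P" "card P \<le> 3"
  shows "\<not> inj_on (cyc_rep n P) {0..<n}"
proof -
  define pos where "pos x = nat (x mod int n)" for x
  define c where "c x = (THE S. S \<in> P \<and> pos x \<in> S)" for x
  define D where "D S x = Min (cyc_dist n (pos x) ` S)" for S x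
  have pos: "pos x < n" for x using assms(1) by (simp add: pos_def nat_less_iff)
  have "\<exists>!S. S \<in> P \<and> pos x \<in> S" for x
    using partition_onD1[OF assms(2)] partition_onD2[OF assms(2)] pos[of x]
    by (metis UnionE atLeastLessThan_iff disjoint_def disjoint_iff zero_le)
  from theI'[OF this] have c: "c x \<in> P" "pos x \<in> c x" for x by (simp_all add: c_def)
  have c_eq: "c x = S" if "S \<in> P" "pos x \<in> S" for x S
    using partition_onD2[OF assms(2)] c[of x] that by (auto simp: disjoint_def)
  have sub: "S \<subseteq> {0..<n}" "finite S" "S \<noteq> {}" if "S \<in> P" for S
    using that assms(2) by (auto simp: partition_on_def intro: finite_subset)
  have "c ` {0..<int n} = P"
  proof
    show "P \<subseteq> c ` {0..<int n}"
    proof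
      fix S assume S: "S \<in> P"
      then obtain v where v: "v \<in> S" "v < n" using sub by fastforce
      then have "c (int v) = S" using S by (intro c_eq) (simp_all add: pos_def)
      then show "S \<in> c ` {0..<int n}" using v(2) by force
    qed
  qed (use c in blast)
  moreover have "D (c y) x \<le> nat \<bar>y - x\<bar>" for x y
  proof -
    have "D (c y) x \<le> cyc_dist n (pos x) (pos y)"
      unfolding D_def using c sub by (intro Min_le) auto
    also have "\<dots> \<le> nat \<bar>y - x\<bar>"
      using cyc_dist_mod_le assms(1) by (simp add: pos_def)
    finally show ?thesis .
  qed
  moreover have "c (x + int (D S x)) = S \<or> c (x - int (D S x)) = S" if "S \<in> P" for S x
  proof -
    have "D S x \<in> cyc_dist n (pos x) ` S"
      unfolding D_def using sub[OF that] by (intro Min_in) auto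
    then obtain v where v: "v \<in> S" "D S x = cyc_dist n (pos x) v" by blast
    then have "v < n" using sub[OF that] by auto
    from cyc_dist_mod_attained[OF this, of x] v(2)
    have "pos (x + int (D S x)) = v \<or> pos (x - int (D S x)) = v"
      by (auto simp: pos_def)
    with c_eq[OF that] v(1) show ?thesis by metis
  qed
  ultimately obtain x y where xy: "x mod int n \<noteq> y mod int n"
    "image_mset (\<lambda>S. D S x) (mset_set P) = image_mset (\<lambda>S. D S y) (mset_set P)"
    using colouring_with_three_colours_not_resolving[of n c P D] assms c(1) by blast
  have "pos x \<noteq> pos y" using xy(1) assms(1) by (simp add: pos_def eq_nat_nat_iff)
  moreover have "cyc_rep n P (pos x) = cyc_rep n P (pos y)"
    using xy(2) by (simp add: cyc_rep_def D_def)
  ultimately show ?thesis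
    using pos by (metis atLeastLessThan_iff inj_onD zero_le)
qed

section \<open>Four parts suffice for at least nine vertices\<close>

text \<open>Turns an equation of multisets into the six possible matchings, which linear arithmetic
  can handle one by one.\<close>

lemma three_mset_eqD:
  fixes a b c :: 'a
  assumes "{#a, b, c#} = {#x, y, z#}"
  shows "(a = x \<and> b = y \<and> c = z) \<or> (a = x \<and> b = z \<and> c = y) \<or> (a = y \<and> b = x \<and> c = z)
    \<or> (a = y \<and> b = z \<and> c = x) \<or> (a = z \<and> b = x \<and> c = y) \<or> (a = z \<and> b = y \<and> c = x)"
proof -
  have two: "{#p, q#} = {#r, s#} \<Longrightarrow> p = r \<and> q = s \<or> p = s \<and> q = r" for p q r s :: 'a
    by (auto simp: add_mset_eq_single add_eq_conv_diff)
  have "a \<in># {#x, y, z#}" using assms by (metis union_single_eq_member)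
  then consider "a = x" | "a = y" | "a = z" by auto
  then show ?thesis
  proof cases
    case 1
    then have "{#b, c#} = {#y, z#}" using assms by simp
    from two[OF this] 1 show ?thesis by blast
  next
    case 2
    then have "{#b, c#} = {#x, z#}" using assms add_mset_commute[of x y] by simp
    from two[OF this] 2 show ?thesis by blast
  next
    case 3
    then have "{#b, c#} = {#x, y#}"
      using assms add_mset_commute[of x z] add_mset_commute[of y z] by simp
    from two[OF this] 3 show ?thesis by blast
  qed
qed

text \<open>
  The last four cases tell which of the vertices \<open>0, 1, 4\<close> are nearer to \<open>w\<close> clockwise than
  anticlockwise.
\<close>

lemma cyc_dist_0_1_4_cases:
  assumes "n \<ge> 9" "w < n" "w \<notin> {0, 1, 4}"
    and "d0 = cyc_dist n w 0" "d1 = cyc_dist n w 1" "d4 = cyc_dist n w 4"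
  shows "w = 2 \<and> d0 = 2 \<and> d1 = 1 \<and> d4 = 2 \<or> w = 3 \<and> d0 = 3 \<and> d1 = 2 \<and> d4 = 1
    \<or> 5 \<le> w \<and> 2 * w \<le> n \<and> d0 = w \<and> d1 + 1 = w \<and> d4 + 4 = w
    \<or> n < 2 * w \<and> 2 * w \<le> n + 2 \<and> d0 + w = n \<and> d1 + 1 = w \<and> d4 + 4 = w
    \<or> n + 2 < 2 * w \<and> 2 * w \<le> n + 8 \<and> d0 + w = n \<and> d1 + w = n + 1 \<and> d4 + 4 = w
    \<or> n + 8 < 2 * w \<and> d0 + w = n \<and> d1 + w = n + 1 \<and> d4 + w = n + 4"
proof -
  have "w \<noteq> 0" "w \<noteq> 1" "w \<noteq> 4" using assms(3) by auto
  then consider "w = 2" | "w = 3" | "5 \<le> w" by linarith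
  then show ?thesis
  proof cases
    case 3
    have "d0 = (if 2 * w \<le> n then w else n - w)"
      using 3 assms(2,4) by (auto simp: cyc_dist_def Let_def min_def)
    moreover have "d1 = (if 2 * w \<le> n + 2 then w - 1 else n + 1 - w)"
      using 3 assms(2,5) by (auto simp: cyc_dist_def Let_def min_def)
    moreover have "d4 = (if 2 * w \<le> n + 8 then w - 4 else n + 4 - w)"
      using 3 assms(2,6) by (auto simp: cyc_dist_def Let_def min_def)
    ultimately show ?thesis
      using 3 assms(2) by (cases "2 * w \<le> n"; cases "2 * w \<le> n + 2"; cases "2 * w \<le> n + 8") simp_all
  qed (use assms in \<open>simp_all add: cyc_dist_def\<close>)
qed

text \<open>Six positions for each vertex and six matchings of the distances give linear systems,
  each of which is contradictory or forces \<open>u = v\<close>.\<close>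

lemma cyc_dists_inj:
  assumes "n \<ge> 9" "u < n" "v < n" "u \<notin> {0, 1, 4}" "v \<notin> {0, 1, 4}"
    and "{#cyc_dist n u 0, cyc_dist n u 1, cyc_dist n u 4#} =
      {#cyc_dist n v 0, cyc_dist n v 1, cyc_dist n v 4#}"
  shows "u = v"
  using cyc_dist_0_1_4_cases[OF assms(1,2,4) refl refl refl]
    cyc_dist_0_1_4_cases[OF assms(1,3,5) refl refl refl] three_mset_eqD[OF assms(6)] assms(1-3)
  by (elim disjE conjE) linarith+

definition four_parts :: "nat \<Rightarrow> nat set set" where
  "four_parts n = {{0}, {1}, {4}, {0..<n} - {0, 1, 4}}"

lemma mset_set_four_parts:
  assumes "n \<ge> 9"
  shows "mset_set (four_parts n) = {#{0..<n} - {0, 1, 4}, {0}, {1}, {4}#}"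
proof -
  \<comment> \<open>Vertex \<open>2\<close> distinguishes the large part from the three
    singletons.\<close>
  have "2 \<in> {0..<n} - {0, 1, 4}" using assms by auto
  then have "{0..<n} - {0, 1, 4} \<notin> {{0}, {1}, {4}}" by force
  moreover have "four_parts n = insert ({0..<n} - {0, 1, 4}) {{0}, {1}, {4}}"
    by (auto simp: four_parts_def)
  ultimately show ?thesis by simp
qed

lemma partition_on_four_parts:
  assumes "n \<ge> 9"
  shows "partition_on {0..<n} (four_parts n)"
proof (rule partition_onI)
  show "\<Union> (four_parts n) = {0..<n}" using assms by (auto simp: four_parts_def)
  have "2 \<in> {0..<n} - {0, 1, 4}" using assms by auto
  then show "{} \<notin> four_parts n" by (auto simp: four_parts_def)
qed (auto simp: four_parts_def disjnt_def)

lemma card_four_parts: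
  assumes "n \<ge> 9"
  shows "card (four_parts n) = 4"
proof -
  have "card (four_parts n) = size (mset_set (four_parts n))" by simp
  also have "\<dots> = 4" by (simp only: mset_set_four_parts[OF assms]) simp
  finally show ?thesis .
qed

lemma cyc_rep_four_parts:
  assumes "n \<ge> 9" "v < n"
  shows "cyc_rep n (four_parts n) v =
    add_mset (if v \<in> {0, 1, 4} then 1 else 0) {#cyc_dist n v 0, cyc_dist n v 1, cyc_dist n v 4#}"
proof -
  have "Min (cyc_dist n v ` ({0..<n} - {0, 1, 4})) = (if v \<in> {0, 1, 4} then 1 else 0)"
  proof (rule Min_eqI)
    show "(if v \<in> {0, 1, 4} then 1 else 0) \<le> y" if y: "y \<in> cyc_dist n v ` ({0..<n} - {0, 1, 4})" for y
    proof -
      obtain x where "x \<in> {0..<n} - {0, 1, 4}" "y = cyc_dist n v x" using y by blast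
      then have "x < n" "x \<notin> {0, 1, 4}" "y = cyc_dist n v x" by auto
      then have "y \<noteq> 0" if "v \<in> {0, 1, 4}"
        using that assms(2) cyc_dist_eq_0_iff[of v n x] by metis
      then show ?thesis by (simp add: Suc_le_eq)
    qed
    \<comment> \<open>Each of \<open>0\<close>, \<open>1\<close>, \<open>4\<close> has a neighbour
      in the large part, namely \<open>n - 1\<close>, \<open>2\<close>, \<open>5\<close>.\<close>
    have "cyc_dist n 0 (n - 1) = 1" "cyc_dist n 1 2 = 1" "cyc_dist n 4 5 = 1" "cyc_dist n v v = 0"
      using assms(1) by (auto simp: cyc_dist_def)
    moreover have "{2, 5, n - 1} \<subseteq> {0..<n} - {0, 1, 4}" using assms(1) by auto
    ultimately show "(if v \<in> {0, 1, 4} then 1 else 0) \<in> cyc_dist n v ` ({0..<n} - {0, 1, 4})"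
      using assms(2) by (cases "v \<in> {0, 1, 4}") (auto simp: image_iff simp del: One_nat_def intro: rev_image_eqI)
  qed simp
  then show ?thesis
    by (simp add: cyc_rep_def mset_set_four_parts[OF assms(1)])
qed

lemma inj_on_cyc_rep_four_parts:
  assumes n: "n \<ge> 9"
  shows "inj_on (cyc_rep n (four_parts n)) {0..<n}"
proof -
  have dists:
    "cyc_dist n 0 0 = 0" "cyc_dist n 0 1 = 1" "cyc_dist n 0 4 = 4"
    "cyc_dist n 1 0 = 1" "cyc_dist n 1 1 = 0" "cyc_dist n 1 4 = 3"
    "cyc_dist n 4 0 = 4" "cyc_dist n 4 1 = 3" "cyc_dist n 4 4 = 0"
    using n by (auto simp: cyc_dist_def)
  have mixed: "cyc_rep n (four_parts n) u \<noteq> cyc_rep n (four_parts n) v"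
    if "u \<in> {0, 1, 4}" "v \<notin> {0, 1, 4}" "v < n" for u v
  proof
    assume eq: "cyc_rep n (four_parts n) u = cyc_rep n (four_parts n) v"
    have "u < n" using that(1) n by auto
    then have "{#1, cyc_dist n u 0, cyc_dist n u 1, cyc_dist n u 4#} =
        {#0, cyc_dist n v 0, cyc_dist n v 1, cyc_dist n v 4#}"
      using eq that by (simp add: cyc_rep_four_parts n)
    moreover have "{#1, cyc_dist n u 0, cyc_dist n u 1, cyc_dist n u 4#} \<in>
        {{#0, 1, 1, 4#}, {#0, 1, 1, 3#}, {#0, 1, 4, 3#}}"
      using that(1) by (auto simp: dists add_mset_commute simp del: One_nat_def)
    \<comment> \<open>Both sides contain a \<open>0\<close>, from the own singleton of
      \<open>u\<close> and from the large part containing \<open>v\<close>; cancelling it leaves the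
      distances of \<open>v\<close> to \<open>0\<close>, \<open>1\<close>, \<open>4\<close>.\<close>
    ultimately have "{#cyc_dist n v 0, cyc_dist n v 1, cyc_dist n v 4#} \<in>
        {{#1, 1, 4#}, {#1, 1, 3#}, {#1, 4, 3#}}" by auto
    then consider "{#cyc_dist n v 0, cyc_dist n v 1, cyc_dist n v 4#} = {#1, 1, 4#}"
      | "{#cyc_dist n v 0, cyc_dist n v 1, cyc_dist n v 4#} = {#1, 1, 3#}"
      | "{#cyc_dist n v 0, cyc_dist n v 1, cyc_dist n v 4#} = {#1, 4, 3#}" by blast
    then show False
      using cyc_dist_0_1_4_cases[OF n that(3,2) refl refl refl] n
      by cases (drule three_mset_eqD, (elim disjE conjE; linarith))+
  qed
  have special: "u = v"
    if "cyc_rep n (four_parts n) u = cyc_rep n (four_parts n) v" "u \<in> {0, 1, 4}" "v \<in> {0, 1, 4}" for u v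
  proof -
    \<comment> \<open>The sum of the distances already separates the three singleton
      vertices.\<close>
    have sum: "sum_mset (cyc_rep n (four_parts n) w) = (if w = 0 then 6 else if w = 1 then 5 else 8)"
      if "w \<in> {0, 1, 4}" for w
      using that n by (auto simp: cyc_rep_four_parts dists simp del: One_nat_def)
    have "(if u = 0 then 6 else if u = 1 then 5 else 8) =
        (if v = 0 then 6 else if v = 1 then 5 else (8 :: nat))"
      using sum[OF that(2)] sum[OF that(3)] unfolding that(1) by (rule trans[OF sym])
    then show ?thesis using that(2,3) by (auto split: if_splits)
  qed
  have rest: "u = v"
    if "cyc_rep n (four_parts n) u = cyc_rep n (four_parts n) v" "u \<notin> {0, 1, 4}" "v \<notin> {0, 1, 4}"
      "u < n" "v < n" for u v
    using that n by (intro cyc_dists_inj[of n u v]) (simp_all add: cyc_rep_four_parts)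
  show ?thesis
  proof (rule inj_onI)
    fix u v assume "u \<in> {0..<n}" "v \<in> {0..<n}"
      and eq: "cyc_rep n (four_parts n) u = cyc_rep n (four_parts n) v"
    then have "u < n" "v < n" by auto
    with eq mixed[of u v] mixed[of v u] special[of u v] rest[of u v] show "u = v" by metis
  qed
qed

section \<open>The dimension of the cycle\<close>

theorem theorem3p2:
  fixes n :: nat
  assumes "n \<ge> 3"
  shows "mpd (cycle_graph n) = (if n \<le> 7 then \<infinity> else if n = 8 then 5 else 4)"
proof -
  consider "n \<le> 7" | "n = 8" | "n \<ge> 9" by linarith
  then show ?thesis
  proof cases
    case 1
    then have "n \<in> set [3, 4, 5, 6, 7]" using assms by auto
    with search_three_to_seven_vertices
    have search: "all_partitions n (map (\<lambda>u. map (cyc_dist n u) [0..<n]) (rev [0..<n]))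
        (\<lambda>p. \<not> distinct (row_reps n p))"
      unfolding list_all_iff by blast
    have "\<not> resolving_multiset_partition (cycle_graph n) P" for P
      using not_inj_on_cyc_rep_by_search[OF search] card_partition_on_le[of "{0..<n}" P]
      by (auto simp: resolving_cycle_graph_iff assms)
    \<comment> \<open>The infimum is over the empty set, hence the top element of
      \<open>enat\<close>.\<close>
    then show ?thesis using 1 by (simp add: mpd_def top_enat_def)
  next
    case 2
    let ?P = "{{0}, {1}, {3}, {5}, {2, 4, 6, 7::nat}}"
    have "partition_on {0..<8} ?P"
      by (rule partition_onI) (auto simp: disjnt_def)
    then have "resolving_multiset_partition (cycle_graph n) ?P"
      using inj_on_cyc_rep_five_parts assms 2 by (simp add: resolving_cycle_graph_iff)
    moreover have "card ?P = 5"
    proof -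
      have "card ?P = size (mset_set ?P)" by simp
      also have "\<dots> = 5" by (simp only: mset_set_five_parts) simp
      finally show ?thesis .
    qed
    moreover have "5 \<le> card Q" if "resolving_multiset_partition (cycle_graph n) Q" for Q
      using not_inj_on_cyc_rep_by_search[OF search_eight_vertices, of Q] that assms 2
      by (fastforce simp: resolving_cycle_graph_iff)
    ultimately have "mpd (cycle_graph n) = enat 5" by (rule mpd_eqI)
    with 2 show ?thesis by (simp add: numeral_eq_enat)
  next
    case 3
    have "resolving_multiset_partition (cycle_graph n) (four_parts n)"
      using partition_on_four_parts inj_on_cyc_rep_four_parts assms 3
      by (simp add: resolving_cycle_graph_iff)
    moreover have "4 \<le> card Q" if "resolving_multiset_partition (cycle_graph n) Q" for Q
      using not_inj_on_cyc_rep_three[OF assms, of Q] that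
      by (fastforce simp: resolving_cycle_graph_iff assms)
    ultimately have "mpd (cycle_graph n) = enat 4"
      using card_four_parts[OF 3] by (intro mpd_eqI)
    with 3 show ?thesis by (simp add: numeral_eq_enat)
  qed
qed

end
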